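(* Let $q$ be any prime power, let $d\ge2$, fix a nondegenerate bilinear pairing $\langle\cdot,\cdot\rangle$ on $\mathbb F_q^d$, let $Y\subseteq\mathbb F_q^d$ be nonempty, and let $T\subseteq\mathbb F_q^d$ be a set of $m\ge2$ pairwise nonproportional nonzero pins. Suppose $$|\Pi_p(Y)|\le(1-\alpha)q\qquad(p\in T)$$ for some $0<\alpha<1$ and let $C_1\ge1$, and suppose $$(1-\alpha)^3mq^3\le C_1^2\alpha^2|Y|.$$ Then there exist distinct pins $p,p'\in T$ and attained values $t\in\Pi_p(Y)$, $t'\in\Pi_{p'}(Y)$ for which $$|\{x\in Y:\langle p,x\rangle=t,\ \langle p',x\rangle=t'\}|\ge\frac{\alpha}{8C_1\sqrt{1-\alpha}}\sqrt{\frac{m|Y|}q}.\tag{*}$$ At least $$\frac{3|Y|m(m-1)}{4q^{d-2}}$$ ordered choices $((p,t),(p',t'))$ (with $p\ne p'$ in $T$, $t\in\Pi_p(Y)$, $t'\in\Pi_{p'}(Y)$) satisfy ( * ).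
   Context: $\Pi_p(Y)=\{\langle p,x\rangle:x\in Y\}$. *)

theory Defs
  imports "HOL-Analysis.Analysis"
begin

text \<open>
  The space \<open>F\<^sub>q^d\<close> is \<open>'a ^ 'n\<close> for a finite field \<open>'a\<close> with \<open>q\<close> elements (so \<open>q\<close> is
  automatically a prime power) and a finite index type \<open>'n\<close> with \<open>d\<close> elements.
\<close>

definition nondegenerate_bilinear ::
  "('a::field ^ 'n \<Rightarrow> 'a ^ 'n \<Rightarrow> 'a) \<Rightarrow> bool" where
  "nondegenerate_bilinear B \<longleftrightarrow>
     (\<forall>x. Vector_Spaces.linear (*s) (*) (\<lambda>y. B x y)) \<and>
     (\<forall>y. Vector_Spaces.linear (*s) (*) (\<lambda>x. B x y)) \<and>
     (\<forall>x. (\<forall>y. B x y = 0) \<longrightarrow> x = 0) \<and>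
     (\<forall>y. (\<forall>x. B x y = 0) \<longrightarrow> y = 0)"

definition pinned_values ::
  "('a ^ 'n \<Rightarrow> 'a ^ 'n \<Rightarrow> 'a) \<Rightarrow> ('a ^ 'n) set \<Rightarrow> 'a ^ 'n \<Rightarrow> 'a set" where
  "pinned_values B Y p = {B p x | x. x \<in> Y}"

definition proportional :: "'a::field ^ 'n \<Rightarrow> 'a ^ 'n \<Rightarrow> bool" where
  "proportional u v \<longleftrightarrow> (\<exists>c. u = c *s v \<or> v = c *s u)"

definition joint_fibre ::
  "('a ^ 'n \<Rightarrow> 'a ^ 'n \<Rightarrow> 'a) \<Rightarrow> ('a ^ 'n) set \<Rightarrow>
     'a ^ 'n \<Rightarrow> 'a \<Rightarrow> 'a ^ 'n \<Rightarrow> 'a \<Rightarrow> ('a ^ 'n) set" where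
  "joint_fibre B Y p t p' t' = {x \<in> Y. B p x = t \<and> B p' x = t'}"

end

theory Submission imports Defs
begin

text \<open>
  For each ordered pair of distinct pins the joint fibres partition \<open>Y\<close>. There are at most
  \<open>(1 - \<alpha>)\<^sup>2 q\<^sup>2\<close> of them, and the hypothesis relating \<open>m\<close>, \<open>q\<close> and \<open>|Y|\<close> is such that the fibres
  below the threshold together contain at most \<open>|Y| / 4\<close> points. The remaining \<open>3 |Y| / 4\<close> points
  lie in fibres above the threshold. Nonproportional pins give independent functionals, so each
  fibre has at most \<open>q ^ (d - 2)\<close> points, which bounds the number of large fibres from below.
\<close>

text \<open>Pick \<open>u\<close>, \<open>v\<close> on which the functionals \<open>B p\<close> and
  \<open>B p'\<close> have an invertible 2 by 2 matrix of values. The q^2 translates of the fibre by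
  combinations of \<open>u\<close> and \<open>v\<close> are then pairwise disjoint subsets of a
  space with q^d points.\<close>

lemma card_joint_fibre_le:
  fixes B :: "'a::{field,finite} ^ 'n::finite \<Rightarrow> 'a ^ 'n \<Rightarrow> 'a"
  assumes B: "nondegenerate_bilinear B" and np: "\<not> proportional p p'" and d: "CARD('n) \<ge> 2"
  shows "card (joint_fibre B Y p t p' t') \<le> CARD('a) ^ (CARD('n) - 2)"
proof -
  have linr: "Vector_Spaces.linear (*s) (*) (\<lambda>y. B x y)" for x
    using B by (simp add: nondegenerate_bilinear_def)
  have linl: "Vector_Spaces.linear (*s) (*) (\<lambda>x. B x y)" for y
    using B by (simp add: nondegenerate_bilinear_def)
  have nd: "\<exists>y. B x y \<noteq> 0" if "x \<noteq> 0" for x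
    using B that by (auto simp: nondegenerate_bilinear_def)
  interpret r: Vector_Spaces.linear "(*s)" "(*)" "\<lambda>y. B x y" for x by (rule linr)
  interpret l: Vector_Spaces.linear "(*s)" "(*)" "\<lambda>x. B x y" for y by (rule linl)
  have "p \<noteq> 0"
    using np vector_smult_lzero[of p'] unfolding proportional_def by fastforce
  then obtain u where u: "B p u \<noteq> 0" using nd[of p] by blast
  \<comment> \<open>This \<open>c\<close> makes \<open>B (p' - c *s p)\<close> vanish at
    \<open>u\<close>, so any \<open>v\<close> where that functional is nonzero gives a nonzero
    determinant.\<close>
  define c where "c = B p' u / B p u"
  have "p' - c *s p \<noteq> 0"
    using np unfolding proportional_def by auto
  then obtain v where "B (p' - c *s p) v \<noteq> 0" using nd[of "p' - c *s p"] by blast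
  then have "B p' v - c * B p v \<noteq> 0" by (simp add: l.diff l.scale)
  then have det: "B p u * B p' v - B p' u * B p v \<noteq> 0"
    using u by (simp add: c_def field_simps)
  let ?F = "joint_fibre B Y p t p' t'"
  define f where "f = (\<lambda>(x, a, b). x + a *s u + b *s v)"
  have "inj_on f (?F \<times> UNIV \<times> UNIV)"
  proof (rule inj_onI, clarsimp)
    fix x a b x' a' b'
    assume xs: "x \<in> ?F" "x' \<in> ?F" and eq: "f (x, a, b) = f (x', a', b')"
    have "B p (f (x, a, b)) = B p (f (x', a', b'))" "B p' (f (x, a, b)) = B p' (f (x', a', b'))"
      by (simp_all only: eq)
    \<comment> \<open>Both \<open>x\<close> and \<open>x'\<close> take the values \<open>t\<close>
      and \<open>t'\<close>, so they cancel and a homogeneous linear system in \<open>a - a'\<close>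
      and \<open>b - b'\<close> remains. It is solved below by Cramer's rule.\<close>
    then have 1: "(a - a') * B p u + (b - b') * B p v = 0"
      and 2: "(a - a') * B p' u + (b - b') * B p' v = 0"
      using xs by (simp_all add: f_def joint_fibre_def r.add r.scale algebra_simps)
    have "(a - a') * (B p u * B p' v - B p' u * B p v)
        = ((a - a') * B p u + (b - b') * B p v) * B p' v
          - ((a - a') * B p' u + (b - b') * B p' v) * B p v"
      by (simp add: algebra_simps)
    then have a: "a = a'" using det by (simp add: 1 2)
    have "(b - b') * (B p u * B p' v - B p' u * B p v)
        = ((a - a') * B p' u + (b - b') * B p' v) * B p u
          - ((a - a') * B p u + (b - b') * B p v) * B p' u"
      by (simp add: algebra_simps)
    then have b: "b = b'" using det by (simp add: 1 2)
    show "x = x' \<and> a = a' \<and> b = b'" using a b eq by (simp add: f_def)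
  qed
  then have "card (?F \<times> (UNIV :: 'a set) \<times> (UNIV :: 'a set)) \<le> CARD('a ^ 'n)"
    by (rule card_inj_on_le) auto
  moreover have "CARD('a) ^ CARD('n) = CARD('a) ^ (CARD('n) - 2) * CARD('a) ^ 2"
    using d by (simp only: power_add[symmetric] le_add_diff_inverse2)
  ultimately have "card ?F * CARD('a) ^ 2 \<le> CARD('a) ^ (CARD('n) - 2) * CARD('a) ^ 2"
    by (simp add: card_cartesian_product power2_eq_square)
  then show ?thesis by simp
qed

text \<open>Each \<open>x\<close> in \<open>Y\<close> is counted exactly once, at the attained pair
  \<open>(B p x, B p' x)\<close>.\<close>

lemma sum_card_joint_fibre:
  fixes B :: "'a::{field,finite} ^ 'n::finite \<Rightarrow> 'a ^ 'n \<Rightarrow> 'a"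
  shows "(\<Sum>(t, t')\<in>pinned_values B Y p \<times> pinned_values B Y p'. card (joint_fibre B Y p t p' t'))
    = card Y"
proof -
  have "card Y = card (\<Union>z\<in>pinned_values B Y p \<times> pinned_values B Y p'.
      joint_fibre B Y p (fst z) p' (snd z))"
    by (rule arg_cong[where f = card]) (auto simp: joint_fibre_def pinned_values_def)
  also have "\<dots> = (\<Sum>z\<in>pinned_values B Y p \<times> pinned_values B Y p'.
      card (joint_fibre B Y p (fst z) p' (snd z)))"
    by (rule card_UN_disjoint) (auto simp: joint_fibre_def)
  finally show ?thesis by (simp add: case_prod_beta)
qed

text \<open>Split the sum at the threshold: large terms cost at most \<open>M\<close> each, small
  ones at most \<open>L\<close> each. As \<open>L\<close> is nonnegative, the number of small terms
  may be replaced by \<open>card A\<close>.\<close>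

lemma sum_le_card_large:
  fixes g :: "'b \<Rightarrow> real"
  assumes "finite A" and "0 \<le> L" and "\<And>z. z \<in> A \<Longrightarrow> g z \<le> M"
  shows "sum g A \<le> real (card {z \<in> A. L \<le> g z}) * M + real (card A) * L"
proof -
  have "sum g A = sum g {z \<in> A. L \<le> g z} + sum g {z \<in> A. \<not> L \<le> g z}"
    using assms(1) by (subst sum.union_disjoint[symmetric]) (auto intro!: sum.cong)
  also have "sum g {z \<in> A. L \<le> g z} \<le> real (card {z \<in> A. L \<le> g z}) * M"
    using assms(3) by (intro sum_bounded_above) auto
  also have "sum g {z \<in> A. \<not> L \<le> g z} \<le> real (card {z \<in> A. \<not> L \<le> g z}) * L"
    by (intro sum_bounded_above) auto
  also have "\<dots> \<le> real (card A) * L"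
    using assms(1,2) by (intro mult_right_mono) (auto intro: card_mono)
  finally show ?thesis by simp
qed

text \<open>Squaring removes the roots. The hypothesis trades m q^3 for y and cancels C; the
  constant 8 gives y^2 / 64, within the required y^2 / 16.\<close>

lemma threshold_le:
  fixes \<alpha> C m q y :: real
  assumes "0 < \<alpha>" "\<alpha> < 1" "1 \<le> C" "0 \<le> m" "0 < q" "0 \<le> y"
    and "(1 - \<alpha>) ^ 3 * m * q ^ 3 \<le> C ^ 2 * \<alpha> ^ 2 * y"
  shows "((1 - \<alpha>) * q) ^ 2 * (\<alpha> / (8 * C * sqrt (1 - \<alpha>)) * sqrt (m * y / q)) \<le> y / 4"
    (is "?l \<le> _")
proof (rule power2_le_imp_le)
  define b where "b = 1 - \<alpha>"
  have b: "0 < b" using assms(2) by (simp add: b_def)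
  have "?l ^ 2 = (b * q) ^ 4 * (\<alpha> ^ 2 / (64 * C ^ 2 * b) * (m * y / q))"
    using assms(4-6) b unfolding b_def[symmetric] by (simp add: power_mult_distrib power_divide)
  \<comment> \<open>One factor b * q of the fourth power cancels against the denominators, which
    isolates the left side of the hypothesis.\<close>
  also have "\<dots> = (b ^ 3 * m * q ^ 3) * (\<alpha> ^ 2 * y / (64 * C ^ 2))"
    using assms(3,5) b by (simp add: divide_simps) (simp add: eval_nat_numeral)
  also have "\<dots> \<le> (C ^ 2 * \<alpha> ^ 2 * y) * (\<alpha> ^ 2 * y / (64 * C ^ 2))"
    using assms(6,7) unfolding b_def by (intro mult_right_mono) auto
  also have "\<dots> = \<alpha> ^ 4 * (y ^ 2 / 64)"
    using assms(3) by (simp add: divide_simps) (simp add: eval_nat_numeral)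
  also have "\<dots> \<le> 1 * (y ^ 2 / 64)"
    using assms(1,2) by (intro mult_right_mono power_le_one) auto
  also have "\<dots> \<le> (y / 4) ^ 2" by (simp add: power_divide)
  finally show "?l ^ 2 \<le> (y / 4) ^ 2" .
  show "0 \<le> y / 4" using assms by simp
qed

theorem theorem5p5:
  fixes B :: "'a::{field,finite} ^ 'n::finite \<Rightarrow> 'a ^ 'n \<Rightarrow> 'a"
    and Y T :: "('a ^ 'n) set"
    and q d m :: nat
    and \<alpha> C\<^sub>1 :: real
  assumes "CARD('a) = q"
    and "CARD('n) = d" and "d \<ge> 2"
    and "nondegenerate_bilinear B"
    and "Y \<noteq> {}"
    and "card T = m" and "m \<ge> 2"
    and "0 \<notin> T"
    and "pairwise (\<lambda>u v. \<not> proportional u v) T"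
    and "0 < \<alpha>" and "\<alpha> < 1" and "C\<^sub>1 \<ge> 1"
    and "\<forall>p\<in>T. real (card (pinned_values B Y p)) \<le> (1 - \<alpha>) * real q"
    and "(1 - \<alpha>) ^ 3 * real m * real q ^ 3 \<le> C\<^sub>1 ^ 2 * \<alpha> ^ 2 * real (card Y)"
  shows "(\<exists>p\<in>T. \<exists>p'\<in>T. p \<noteq> p' \<and>
            (\<exists>t\<in>pinned_values B Y p. \<exists>t'\<in>pinned_values B Y p'.
               real (card (joint_fibre B Y p t p' t'))
                 \<ge> \<alpha> / (8 * C\<^sub>1 * sqrt (1 - \<alpha>)) * sqrt (real m * real (card Y) / real q)))
       \<and> real (card {((p, t), (p', t')) | p t p' t'.
            p \<in> T \<and> p' \<in> T \<and> p \<noteq> p' \<and>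
            t \<in> pinned_values B Y p \<and> t' \<in> pinned_values B Y p' \<and>
            real (card (joint_fibre B Y p t p' t'))
              \<ge> \<alpha> / (8 * C\<^sub>1 * sqrt (1 - \<alpha>)) * sqrt (real m * real (card Y) / real q)})
         \<ge> 3 * real (card Y) * real m * (real m - 1) / (4 * real q ^ (d - 2))"
proof -
  define L where "L = \<alpha> / (8 * C\<^sub>1 * sqrt (1 - \<alpha>)) * sqrt (real m * real (card Y) / real q)"
  define P where "P = Sigma T (\<lambda>p. T - {p})"
  define H where "H = (\<lambda>(p, p'). {z \<in> pinned_values B Y p \<times> pinned_values B Y p'.
    L \<le> real (card (joint_fibre B Y p (fst z) p' (snd z)))})"
  define S where "S = {((p, t), (p', t')) | p t p' t'. p \<in> T \<and> p' \<in> T \<and> p \<noteq> p' \<and>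
    t \<in> pinned_values B Y p \<and> t' \<in> pinned_values B Y p' \<and>
    L \<le> real (card (joint_fibre B Y p t p' t'))}"
  have q: "0 < real q" using assms(1) by auto
  have y: "0 < real (card Y)" using assms(5) by (simp add: card_gt_0_iff)
  have L0: "0 \<le> L" unfolding L_def using assms(10-12) by simp
  have Hcard: "3 * real (card Y) / (4 * real q ^ (d - 2)) \<le> real (card (H z))" if "z \<in> P" for z
  proof -
    obtain p p' where z: "z = (p, p')" and pp: "p \<in> T" "p' \<in> T" "p \<noteq> p'"
      using \<open>z \<in> P\<close> by (auto simp: P_def)
    let ?A = "pinned_values B Y p \<times> pinned_values B Y p'"
    let ?g = "\<lambda>z. real (card (joint_fibre B Y p (fst z) p' (snd z)))"
    have np: "\<not> proportional p p'" using assms(9) pp by (auto simp: pairwise_def)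
    have "real (card Y) = sum ?g ?A"
      by (simp add: sum_card_joint_fibre[of B Y p p', symmetric] case_prod_beta)
    also have "\<dots> \<le> real (card (H z)) * real q ^ (d - 2) + real (card ?A) * L"
      unfolding H_def z prod.case
    proof (rule sum_le_card_large)
      show "?g w \<le> real q ^ (d - 2)" for w
        using card_joint_fibre_le[OF assms(4) np, of Y "fst w" "snd w"] assms(1-3)
        by (simp flip: of_nat_power)
    qed (use L0 in auto)
    also have "real (card ?A) * L \<le> ((1 - \<alpha>) * real q) ^ 2 * L"
      using assms(13) pp L0 assms(11)
      by (auto simp: card_cartesian_product power2_eq_square intro!: mult_right_mono mult_mono)
    also have "\<dots> \<le> real (card Y) / 4"
      unfolding L_def using assms(10-12,14) q y by (intro threshold_le) auto
    \<comment> \<open>The small fibres hold at most a quarter of \<open>Y\<close>, so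
      \<open>card (H z) * q ^ (d - 2)\<close> is at least 3/4 of \<open>card Y\<close>.\<close>
    finally show ?thesis using q by (simp add: field_simps)
  qed
  \<comment> \<open>\<open>Sigma P H\<close> lists the two pins first and then the two values;
    \<open>?f\<close> regroups each pin with its value, injectively, so the count splits over pairs
    of pins.\<close>
  let ?f = "\<lambda>((p, p'), (t, t')). ((p, t), (p', t'))"
  have S: "S = ?f ` Sigma P H"
    by (force simp: S_def P_def H_def image_iff)
  have "card S = card (Sigma P H)"
    unfolding S by (rule card_image) (auto simp: inj_on_def)
  also have "\<dots> = (\<Sum>z\<in>P. card (H z))"
    by (rule card_SigmaI) auto
  finally have "real (card S) = (\<Sum>z\<in>P. real (card (H z)))" by simp
  moreover have "card P = m * (m - 1)"
    using assms(6) by (simp add: P_def)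
  ultimately have "real (m * (m - 1)) * (3 * real (card Y) / (4 * real q ^ (d - 2))) \<le> real (card S)"
    using sum_bounded_below[of P "3 * real (card Y) / (4 * real q ^ (d - 2))"
        "\<lambda>z. real (card (H z))"] Hcard by simp
  then have bound: "3 * real (card Y) * real m * (real m - 1) / (4 * real q ^ (d - 2)) \<le> real (card S)"
    using assms(7) by (simp add: of_nat_diff mult_ac)
  \<comment> \<open>Since m \<ge> 2 and \<open>Y\<close> is nonempty, the count is positive, and
    existence follows from it.\<close>
  have "0 < 3 * real (card Y) * real m * (real m - 1) / (4 * real q ^ (d - 2))"
    using q y assms(7) by simp
  with bound have "S \<noteq> {}" by auto
  then have "\<exists>p\<in>T. \<exists>p'\<in>T. p \<noteq> p' \<and> (\<exists>t\<in>pinned_values B Y p. \<exists>t'\<in>pinned_values B Y p'.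
      L \<le> real (card (joint_fibre B Y p t p' t')))"
    unfolding S_def by blast
  with bound show ?thesis unfolding S_def L_def by blast
qed

end
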